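(* Let $R$ be an elementary divisor domain and let $f(t),g(t)\in R[t]$ be monic polynomials of degrees $m,n$, respectively, where $n\geq m$. Then $f(C_g)\sim I_{n-m}\oplus g(C_f)$.
   Context: An elementary divisor domain (EDD) is an integral domain $R$ such that for every matrix $M$ over $R$ there are unimodular matrices $U,V$ with $UMV$ diagonal and each diagonal entry dividing the next. A square matrix over $R$ is unimodular if its determinant is a unit of $R$ (equivalently, it is invertible over $R$). For a monic polynomial $g(t)=t^n+\sum_{i=0}^{n-1}g_it^i\in R[t]$, the companion matrix $C_g\in R^{n\times n}$ has first row $(-g_{n-1},\dots,-g_1,-g_0)$, entries $1$ in positions $(i+1,i)$ for $1\le i\le n-1$, and $0$ elsewhere (it is the empty matrix if $n=0$). For $f(t)=\sum_i f_it^i\in R[t]$, $f(C_g)=\sum_i f_iC_g^i$. Two matrices $M,N$ of the same size over $R$ are equivalent, $M\sim N$, if $UMV=N$ for some unimodular matrices $U,V$ over $R$. $\oplus$ denotes the block-diagonal direct sum and $I_k$ the $k\times k$ identity matrix. *)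

theory Defs
  imports "Jordan_Normal_Form.Determinant" "HOL-Computational_Algebra.Polynomial"
begin

definition unimodular_mat :: "'a::comm_ring_1 mat \<Rightarrow> bool"
  where "unimodular_mat A \<longleftrightarrow> square_mat A \<and> det A dvd 1"

(* Matrices have arbitrary, possibly rectangular, shape; "M ~ N" entails that M and N have the same
   size. *)
definition equivalent_mat :: "'a::comm_ring_1 mat \<Rightarrow> 'a mat \<Rightarrow> bool"
  where "equivalent_mat M N \<longleftrightarrow>
    (\<exists>U V. U \<in> carrier_mat (dim_row M) (dim_row M) \<and> V \<in> carrier_mat (dim_col M) (dim_col M) \<and>
      unimodular_mat U \<and> unimodular_mat V \<and> U * M * V = N)"

definition elementary_divisor_domain :: "'a::idom itself \<Rightarrow> bool"
  where "elementary_divisor_domain _ \<longleftrightarrow>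
    (\<forall>M :: 'a mat. \<exists>D. equivalent_mat M D \<and> diagonal_mat D \<and>
      (\<forall>i. Suc i < min (dim_row D) (dim_col D) \<longrightarrow> D $$ (i, i) dvd D $$ (Suc i, Suc i)))"

(* Only meaningful for monic g.  Indices are 0-based, so the coefficient at position j of the
   first row is that of t^(n-1-j). *)
definition companion_mat :: "'a::comm_ring_1 poly \<Rightarrow> 'a mat"
  where "companion_mat g = (let n = degree g in
    mat n n (\<lambda>(i, j). if i = 0 then - coeff g (n - 1 - j) else if i = Suc j then 1 else 0))"

(* The value f(A) = sum of f_k A^k at a square matrix A.  The sum is written entrywise, because
   the matrices of one size do not form a type on which the sum operator is available. *)
definition poly_mat :: "'a::comm_ring_1 poly \<Rightarrow> 'a mat \<Rightarrow> 'a mat"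
  where "poly_mat f A = mat (dim_row A) (dim_row A)
    (\<lambda>(i, j). \<Sum>k\<le>degree f. (coeff f k \<cdot>\<^sub>m (A ^\<^sub>m k)) $$ (i, j))"

end

theory Submission
  imports Defs
begin

text \<open>Acting on row vectors, \<open>f(C\<^sub>g)\<close> is multiplication by \<open>f\<close> on \<open>R[t]/(g)\<close> in the basis
  \<open>t\<^sup>n\<^sup>-\<^sup>1, \<dots>, t, 1\<close>. In the target use instead the basis \<open>t\<^sup>k\<^sup>-\<^sup>1 f, \<dots>, f, t\<^sup>m\<^sup>-\<^sup>1, \<dots>, 1\<close>
  with \<open>k = n - m\<close>. In the source use \<open>t\<^sup>k\<^sup>-\<^sup>1, \<dots>, 1\<close>, whose images are the first \<open>k\<close> target basis
  vectors, followed by \<open>-s\<^sub>e\<close> for \<open>e = m - 1, \<dots>, 0\<close>, where \<open>t\<^sup>e g = s\<^sub>e f + r\<^sub>e\<close> is division by the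
  monic \<open>f\<close>. As \<open>-s\<^sub>e f\<close> is congruent to \<open>r\<^sub>e\<close> modulo \<open>g\<close>, and \<open>r\<^sub>e\<close> is \<open>t\<^sup>e g\<close> reduced modulo
  \<open>f\<close>, the matrix becomes the direct sum of \<open>I\<^sub>k\<close> and \<open>g(C\<^sub>f)\<close>. Both families are bases because
  they consist, up to order and sign, of one monic polynomial in each degree below \<open>n\<close>.\<close>

section \<open>Coordinate rows and division by a monic polynomial\<close>

text \<open>Columns run through descending powers \<open>t\<^sup>n\<^sup>-\<^sup>1, \<dots>, 1\<close>, matching \<open>companion_mat\<close>.\<close>

definition coeff_mat :: "nat \<Rightarrow> nat \<Rightarrow> (nat \<Rightarrow> 'a::zero poly) \<Rightarrow> 'a mat"
  where "coeff_mat k n p = mat k n (\<lambda>(i, j). coeff (p i) (n - 1 - j))"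

text \<open>Bounding coefficients rather than asking for \<open>degree p < n\<close> lets
  \<open>n = 0\<close> admit exactly the zero polynomial.\<close>

definition deg_below :: "nat \<Rightarrow> 'a::zero poly \<Rightarrow> bool"
  where "deg_below n p \<longleftrightarrow> (\<forall>i\<ge>n. coeff p i = 0)"

lemma coeff_mat_carrier [simp]: "coeff_mat k n p \<in> carrier_mat k n"
  and dim_coeff_mat [simp]: "dim_row (coeff_mat k n p) = k" "dim_col (coeff_mat k n p) = n"
  and index_coeff_mat [simp]:
    "i < k \<Longrightarrow> j < n \<Longrightarrow> coeff_mat k n p $$ (i, j) = coeff (p i) (n - 1 - j)"
  by (auto simp: coeff_mat_def)

lemma deg_below_degree: "degree p < n \<Longrightarrow> deg_below n p"
  by (simp add: deg_below_def coeff_eq_0)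

lemma deg_below_0 [simp]: "deg_below n 0"
  by (simp add: deg_below_def)

lemma companion_mat_carrier [simp]: "companion_mat g \<in> carrier_mat (degree g) (degree g)"
  by (auto simp: companion_mat_def Let_def)

lemma poly_mat_carrier [simp]: "A \<in> carrier_mat n n \<Longrightarrow> poly_mat f A \<in> carrier_mat n n"
  by (auto simp: poly_mat_def)

text \<open>Applied to a difference, this gives uniqueness of reduced representatives modulo
  \<open>g\<close>.\<close>

lemma deg_below_dvd_eq_0:
  fixes g :: "'a::idom poly"
  assumes "g dvd p" "deg_below (degree g) p"
  shows "p = 0"
proof (rule ccontr)
  assume "p \<noteq> 0"
  with assms(1) have "degree g \<le> degree p"
    by (rule dvd_imp_degree_le)
  with assms(2) have "lead_coeff p = 0"
    by (simp add: deg_below_def)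
  with \<open>p \<noteq> 0\<close> show False
    by simp
qed

lemma monic_division:
  fixes g :: "'a::idom poly"
  assumes "lead_coeff g = 1"
  obtains q r where "p = q * g + r" "deg_below (degree g) r"
proof -
  obtain q r where qr: "pseudo_divmod p g = (q, r)"
    by fastforce
  have "g \<noteq> 0"
    using assms by auto
  \<comment> \<open>Pseudo-division scales \<open>p\<close> by a power of the leading coefficient of
    \<open>g\<close>, which is 1.\<close>
  from pseudo_divmod[OF this qr] assms have "p = q * g + r" "r = 0 \<or> degree r < degree g"
    by (simp_all add: mult.commute)
  moreover from this have "deg_below (degree g) r"
    using deg_below_degree by auto
  ultimately show thesis
    using that by blast
qed

section \<open>Companion matrices as multiplication by t modulo g\<close>

text \<open>The subdiagonal ones raise each power of t by one; the first row replaces the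
  overflowing \<open>t^n\<close> by minus the lower part of \<open>g\<close>.\<close>

lemma coeff_mat_times_companion:
  fixes g :: "'a::idom poly"
  assumes n: "degree g = n"
  shows "coeff_mat k n p * companion_mat g
    = coeff_mat k n (\<lambda>i. pCons 0 (p i) - smult (coeff (p i) (n - 1)) g)"
proof (rule eq_matI)
  fix i j
  assume "i < dim_row (coeff_mat k n (\<lambda>i. pCons 0 (p i) - smult (coeff (p i) (n - 1)) g))"
    "j < dim_col (coeff_mat k n (\<lambda>i. pCons 0 (p i) - smult (coeff (p i) (n - 1)) g))"
  then have i: "i < k" and j: "j < n"
    by auto
  have "(coeff_mat k n p * companion_mat g) $$ (i, j)
      = (\<Sum>l = 0..<n. coeff (p i) (n - 1 - l)
          * (if l = 0 then - coeff g (n - 1 - j) else if l = Suc j then 1 else 0))"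
    using i j n by (auto simp: scalar_prod_def companion_mat_def intro!: sum.cong)
  also have "\<dots> = (\<Sum>l = 0..<n. (if l = 0 then - coeff (p i) (n - 1) * coeff g (n - 1 - j) else 0)
      + (if l = Suc j then coeff (p i) (n - 1 - Suc j) else 0))"
    by (rule sum.cong) auto
  \<comment> \<open>For \<open>j = n - 1\<close> there is no row \<open>Suc j\<close>: the shifted
    polynomial has constant term 0.\<close>
  also have "\<dots> = - coeff (p i) (n - 1) * coeff g (n - 1 - j)
      + (if Suc j < n then coeff (p i) (n - 1 - Suc j) else 0)"
    using j by (simp add: sum.distrib)
  also have "\<dots> = coeff (pCons 0 (p i) - smult (coeff (p i) (n - 1)) g) (n - 1 - j)"
    using j by (auto simp: coeff_pCons split: nat.splits) (metis diff_Suc_eq_diff_pred diff_Suc_1 Suc_diff_Suc)+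
  finally show "(coeff_mat k n p * companion_mat g) $$ (i, j)
      = coeff_mat k n (\<lambda>i. pCons 0 (p i) - smult (coeff (p i) (n - 1)) g) $$ (i, j)"
    using i j by simp
qed (use n in \<open>auto simp: companion_mat_def\<close>)

text \<open>Since \<open>g\<close> is monic, the subtraction cancels the coefficient of
  \<open>t^n\<close> created by the shift.\<close>

lemma deg_below_shift:
  fixes g :: "'a::comm_ring_1 poly"
  assumes g: "lead_coeff g = 1" and n: "degree g = n" and p: "deg_below n p"
  shows "deg_below n (pCons 0 p - smult (coeff p (n - 1)) g)"
  unfolding deg_below_def
proof (intro allI impI)
  fix i
  assume i: "n \<le> i"
  show "coeff (pCons 0 p - smult (coeff p (n - 1)) g) i = 0"
  proof (cases i)
    \<comment> \<open>Here \<open>n = 0\<close>, so \<open>n - 1\<close> truncates to 0 and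
      \<open>p\<close> is zero.\<close>
    case 0
    then have "coeff p (n - 1) = 0"
      using i p by (simp add: deg_below_def)
    with 0 show ?thesis
      by simp
  next
    case (Suc j)
    have "coeff p j = coeff p (n - 1) * coeff g (Suc j)"
    proof (cases "n = Suc j")
      case True
      then have "coeff g (Suc j) = 1"
        using g n by simp
      with True show ?thesis
        by simp
    next
      case False
      then have "n \<le> j" "coeff g (Suc j) = 0"
        using i n Suc by (auto intro: coeff_eq_0)
      then show ?thesis
        using p by (simp add: deg_below_def)
    qed
    with Suc show ?thesis
      by simp
  qed
qed

lemma coeff_mat_times_companion_pow:
  fixes g :: "'a::idom poly"
  assumes g: "lead_coeff g = 1" and n: "degree g = n" and p: "\<And>i. i < k \<Longrightarrow> deg_below n (p i)"
  shows "\<exists>q. coeff_mat k n p * companion_mat g ^\<^sub>m e = coeff_mat k n q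
    \<and> (\<forall>i<k. deg_below n (q i) \<and> g dvd (monom 1 e * p i - q i))"
proof (induction e)
  case 0
  have "coeff_mat k n p * companion_mat g ^\<^sub>m 0 = coeff_mat k n p"
    using n by (simp add: companion_mat_def)
  with p show ?case
    by (auto intro!: exI[of _ p])
next
  case (Suc e)
  then obtain q where q: "coeff_mat k n p * companion_mat g ^\<^sub>m e = coeff_mat k n q"
    "\<And>i. i < k \<Longrightarrow> deg_below n (q i)" "\<And>i. i < k \<Longrightarrow> g dvd (monom 1 e * p i - q i)"
    by blast
  define q' where "q' i = pCons 0 (q i) - smult (coeff (q i) (n - 1)) g" for i
  have C: "companion_mat g \<in> carrier_mat n n"
    using n by auto
  have "coeff_mat k n p * companion_mat g ^\<^sub>m Suc e
      = coeff_mat k n p * companion_mat g ^\<^sub>m e * companion_mat g"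
    using assoc_mult_mat[OF coeff_mat_carrier pow_carrier_mat[OF C] C] by simp
  also have "\<dots> = coeff_mat k n q'"
    unfolding q(1) coeff_mat_times_companion[OF n] q'_def ..
  finally have "coeff_mat k n p * companion_mat g ^\<^sub>m Suc e = coeff_mat k n q'" .
  moreover have "deg_below n (q' i)" if "i < k" for i
    unfolding q'_def using g n q(2) that by (intro deg_below_shift) auto
  moreover have "g dvd (monom 1 (Suc e) * p i - q' i)" if "i < k" for i
  proof -
    \<comment> \<open>The new error is t times the old one plus the multiple of \<open>g\<close>
      just subtracted.\<close>
    have "monom 1 (Suc e) * p i - q' i
        = [:0, 1:] * (monom 1 e * p i - q i) + g * [:coeff (q i) (n - 1):]"
      by (simp add: q'_def monom_Suc algebra_simps)
    with q(3)[OF that] show ?thesis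
      by (metis dvd_add dvd_mult dvd_triv_left)
  qed
  ultimately show ?case
    by blast
qed

text \<open>The rows of the product represent \<open>p i * f\<close> modulo \<open>g\<close>. As
  reduced representatives are unique, any reduced \<open>r i\<close> in the right class gives the
  product.\<close>

lemma coeff_mat_times_poly_mat:
  fixes g :: "'a::idom poly"
  assumes g: "lead_coeff g = 1" and n: "degree g = n" and p: "\<And>i. i < k \<Longrightarrow> deg_below n (p i)"
    and r: "\<And>i. i < k \<Longrightarrow> deg_below n (r i)" and dvd: "\<And>i. i < k \<Longrightarrow> g dvd (p i * f - r i)"
  shows "coeff_mat k n p * poly_mat f (companion_mat g) = coeff_mat k n r"
proof -
  let ?C = "companion_mat g"
  obtain q where q: "\<And>e. coeff_mat k n p * ?C ^\<^sub>m e = coeff_mat k n (q e)"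
    "\<And>e i. i < k \<Longrightarrow> deg_below n (q e i)" "\<And>e i. i < k \<Longrightarrow> g dvd (monom 1 e * p i - q e i)"
  proof -
    have "\<forall>e. \<exists>q. coeff_mat k n p * ?C ^\<^sub>m e = coeff_mat k n q
        \<and> (\<forall>i<k. deg_below n (q i) \<and> g dvd (monom 1 e * p i - q i))"
      by (intro allI coeff_mat_times_companion_pow g n p)
    from choice[OF this] that show thesis
      by blast
  qed
  have C: "?C \<in> carrier_mat n n"
    using n by auto
  note Ce = pow_carrier_mat[OF C]
  \<comment> \<open>Both sides are reduced and congruent to \<open>p i * f\<close> modulo
    \<open>g\<close>.\<close>
  have r_eq: "r i = (\<Sum>e\<le>degree f. smult (coeff f e) (q e i))" if i: "i < k" for i
  proof -
    have "p i * f = (\<Sum>e\<le>degree f. smult (coeff f e) (monom 1 e * p i))"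
    proof -
      have "p i * (\<Sum>e\<le>degree f. monom (coeff f e) e) = (\<Sum>e\<le>degree f. p i * monom (coeff f e) e)"
        by (rule sum_distrib_left)
      also have "\<dots> = (\<Sum>e\<le>degree f. smult (coeff f e) (monom 1 e * p i))"
        by (intro sum.cong refl) (metis mult.commute mult.right_neutral mult_smult_left smult_monom)
      finally show ?thesis
        by (simp only: poly_as_sum_of_monoms)
    qed
    then have "p i * f - (\<Sum>e\<le>degree f. smult (coeff f e) (q e i))
        = (\<Sum>e\<le>degree f. smult (coeff f e) (monom 1 e * p i - q e i))"
      by (simp add: sum_subtractf smult_diff_right)
    then have "g dvd p i * f - (\<Sum>e\<le>degree f. smult (coeff f e) (q e i))"
      using q(3)[OF i] by (auto intro!: dvd_sum dvd_smult)
    from dvd_diff[OF this dvd[OF i]]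
    have "g dvd r i - (\<Sum>e\<le>degree f. smult (coeff f e) (q e i))"
      by simp
    moreover have "deg_below (degree g) (r i - (\<Sum>e\<le>degree f. smult (coeff f e) (q e i)))"
      using r[OF i] q(2)[OF i] n by (simp add: deg_below_def coeff_sum)
    ultimately show ?thesis
      using deg_below_dvd_eq_0 by fastforce
  qed
  show ?thesis
  proof (rule eq_matI)
    fix i j
    assume "i < dim_row (coeff_mat k n r)" "j < dim_col (coeff_mat k n r)"
    then have i: "i < k" and j: "j < n"
      by auto
    have "(coeff_mat k n p * poly_mat f ?C) $$ (i, j)
        = (\<Sum>l = 0..<n. coeff (p i) (n - 1 - l) * (\<Sum>e\<le>degree f. coeff f e * (?C ^\<^sub>m e) $$ (l, j)))"
      using i j C Ce by (auto simp: scalar_prod_def poly_mat_def intro!: sum.cong)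
    also have "\<dots> = (\<Sum>e\<le>degree f. coeff f e * (\<Sum>l = 0..<n. coeff (p i) (n - 1 - l) * (?C ^\<^sub>m e) $$ (l, j)))"
      unfolding sum_distrib_left by (subst sum.swap) (simp add: ac_simps)
    also have "\<dots> = (\<Sum>e\<le>degree f. coeff f e * (coeff_mat k n p * ?C ^\<^sub>m e) $$ (i, j))"
      using i j C Ce by (auto simp: scalar_prod_def intro!: sum.cong)
    also have "\<dots> = coeff_mat k n r $$ (i, j)"
      using i j by (simp add: q(1) r_eq coeff_sum)
    finally show "(coeff_mat k n p * poly_mat f ?C) $$ (i, j) = coeff_mat k n r $$ (i, j)" .
  qed (use n in \<open>auto simp: poly_mat_def companion_mat_def\<close>)
qed

section \<open>Unit determinants and equivalence by change of basis\<close>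

text \<open>Degrees drop by one from row to row, so the matrix is upper triangular with the leading
  coefficients on its diagonal.\<close>

lemma det_coeff_mat_unit:
  fixes p :: "nat \<Rightarrow> 'a::idom poly"
  assumes "\<And>i. i < n \<Longrightarrow> degree (p i) = n - 1 - i" "\<And>i. i < n \<Longrightarrow> lead_coeff (p i) dvd 1"
  shows "det (coeff_mat n n p) dvd 1"
proof -
  have "upper_triangular (coeff_mat n n p)"
    using assms(1) by (auto intro!: upper_triangularI coeff_eq_0)
  then have "det (coeff_mat n n p) = (\<Prod>i = 0..<n. coeff_mat n n p $$ (i, i))"
    by (subst det_upper_triangular[of _ n]) (auto simp: diag_mat_def prod.list_conv_set_nth)
  also have "\<dots> = (\<Prod>i = 0..<n. lead_coeff (p i))"
    using assms(1) by (intro prod.cong) auto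
  also have "\<dots> dvd (\<Prod>i = 0..<n. 1)"
    using assms(2) by (intro prod_dvd_prod) auto
  finally show ?thesis
    by simp
qed

lemma equivalent_matI:
  fixes M N U B :: "'a::idom mat"
  assumes carrier: "M \<in> carrier_mat n n" "N \<in> carrier_mat n n" "U \<in> carrier_mat n n"
      "B \<in> carrier_mat n n"
    and units: "det U dvd 1" "det B dvd 1"
    and eq: "U * M = N * B"
  shows "equivalent_mat M N"
proof -
  obtain c where c: "1 = det B * c"
    using units(2) by (rule dvdE)
  \<comment> \<open>The inverse of \<open>B\<close>: its adjugate divided by the unit
    \<open>det B\<close>.\<close>
  define V where "V = c \<cdot>\<^sub>m adj_mat B"
  note adj = adj_mat[OF carrier(4)]
  have V: "V \<in> carrier_mat n n"
    using adj(1) by (simp add: V_def)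
  have BV: "B * V = 1\<^sub>m n"
  proof -
    have "B * V = c \<cdot>\<^sub>m (det B \<cdot>\<^sub>m 1\<^sub>m n)"
      by (simp only: V_def mult_smult_distrib[OF carrier(4) adj(1)] adj(2))
    also have "\<dots> = (det B * c) \<cdot>\<^sub>m 1\<^sub>m n"
      by (intro eq_matI) simp_all
    finally show ?thesis
      by (intro eq_matI) (simp_all flip: c)
  qed
  have "U * M * V = N"
    unfolding eq assoc_mult_mat[OF carrier(2,4) V] BV using carrier(2) by simp
  moreover have "det V dvd 1"
    using dvd_triv_right[of "det V" "det B"] unfolding det_mult[OF carrier(4) V, symmetric] BV by simp
  ultimately show ?thesis
    unfolding equivalent_mat_def unimodular_mat_def using carrier(1,3) V units(1)
    by (intro exI[of _ U] exI[of _ V]) auto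
qed

section \<open>The bases relating f(C_g) to g(C_f)\<close>

theorem theorem3p11:
  fixes f g :: "'a::idom poly" and m n :: nat
  assumes "elementary_divisor_domain TYPE('a)"
    and "lead_coeff f = 1" and "lead_coeff g = 1"
    and "degree f = m" and "degree g = n"
    and "n \<ge> m"
  shows "equivalent_mat (poly_mat f (companion_mat g))
    (diag_block_mat [1\<^sub>m (n - m), poly_mat g (companion_mat f)])"
proof -
  define k where "k = n - m"
  have nk: "n = k + m"
    using assms(6) by (simp add: k_def)
  have f0: "f \<noteq> 0" and g0: "g \<noteq> 0"
    using assms(2,3) by auto
  define F where "F = poly_mat f (companion_mat g)"
  define G where "G = poly_mat g (companion_mat f)"
  have F: "F \<in> carrier_mat n n" and G: "G \<in> carrier_mat m m"
    using assms(4,5) by (auto simp: F_def G_def)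
  let ?t = "\<lambda>e. monom (1::'a) e"
  have "\<exists>s r. ?t e * g = s * f + r \<and> deg_below m r" for e
    by (rule monic_division[OF assms(2), of "?t e * g"]) (unfold assms(4), blast)
  then have "\<forall>e. \<exists>s r. ?t e * g = s * f + r \<and> deg_below m r" ..
  from choice[OF this] obtain s
    where "\<forall>e. \<exists>r. ?t e * g = s e * f + r \<and> deg_below m r" ..
  from choice[OF this] obtain r
    where sr: "\<And>e. ?t e * g = s e * f + r e" "\<And>e. deg_below m (r e)" by blast
  have s: "degree (s e) = k + e" "lead_coeff (s e) = 1" for e
  proof -
    \<comment> \<open>The remainder lies below degree \<open>m\<close>, so \<open>s e * f\<close>
      and \<open>t^e g\<close> share all coefficients from \<open>m\<close> upwards, in particular
      the top one at \<open>n + e\<close>.\<close>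
    have c: "coeff (s e * f) i = coeff (?t e * g) i" if "i \<ge> m" for i
      using sr(2)[of e] that by (simp add: sr(1) deg_below_def)
    have top: "coeff (s e * f) (n + e) = 1"
      using c[of "n + e"] nk assms(3,5) by (simp add: coeff_monom_mult)
    moreover have "degree (s e * f) \<le> n + e"
    proof (intro degree_le allI impI)
      fix i
      assume "n + e < i"
      then show "coeff (s e * f) i = 0"
        using nk assms(5) by (subst c) (simp_all add: coeff_monom_mult coeff_eq_0)
    qed
    ultimately have deg: "degree (s e * f) = n + e"
      by (intro antisym le_degree) simp_all
    moreover have "s e \<noteq> 0"
      using top by auto
    ultimately show "degree (s e) = k + e"
      using f0 assms(4) nk by (simp add: degree_mult_eq)
    show "lead_coeff (s e) = 1"
      using top assms(2) lead_coeff_mult[of "s e" f] by (simp add: deg)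
  qed

  \<comment> \<open>\<open>b\<close> is the target basis and \<open>d\<close> holds the reduced
    images of the source basis. \<open>u\<close> lists the source basis by descending degree, as the
    determinant lemma requires; \<open>\<pi>\<close> moves \<open>t^(k-1), ..., 1\<close> to the
    front.\<close>
  define b where "b i = (if i < k then ?t (k - 1 - i) * f else ?t (n - 1 - i))" for i
  define d where "d i = (if i < k then ?t (k - 1 - i) * f else r (n - 1 - i))" for i
  define u where "u i = (if i < m then - s (m - 1 - i) else ?t (n - 1 - i))" for i
  define \<pi> where "\<pi> i = (if i < k then m + i else if i < n then i - k else i)" for i
  have deg_b: "degree (b i) = n - 1 - i" if "i < n" for i
    using that f0 assms(4) nk by (auto simp: b_def degree_mult_eq monom_eq_0_iff degree_monom_eq)
  have b_unit: "det (coeff_mat n n b) dvd 1"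
    using assms(2) by (intro det_coeff_mat_unit deg_b) (auto simp: b_def lead_coeff_mult degree_monom_eq)
  have deg_u: "degree (u i) = n - 1 - i" if "i < n" for i
    using that nk s(1) by (auto simp: u_def degree_monom_eq)
  have u_unit: "det (coeff_mat n n u) dvd 1"
    by (intro det_coeff_mat_unit deg_u) (auto simp: u_def degree_monom_eq s(2))
  have \<pi>: "\<pi> permutes {0..<n}"
  proof (rule bij_imp_permutes)
    show "bij_betw \<pi> {0..<n} {0..<n}"
      by (rule bij_betwI[where g = "\<lambda>i. if i < m then k + i else i - m"])
        (auto simp: \<pi>_def nk)
  qed (auto simp: \<pi>_def nk)
  have "coeff_mat n n (u \<circ> \<pi>) = mat n n (\<lambda>(i, j). coeff_mat n n u $$ (\<pi> i, j))"
    using permutes_in_image[OF \<pi>] by (intro eq_matI) auto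
  then have "det (coeff_mat n n (u \<circ> \<pi>)) = signof \<pi> * det (coeff_mat n n u)"
    using det_permute_rows[OF coeff_mat_carrier \<pi>] by simp
  then have u\<pi>_unit: "det (coeff_mat n n (u \<circ> \<pi>)) dvd 1"
    using u_unit by (auto simp: sign_def)

  have low_d: "deg_below n (d i)" if "i < n" for i
    using that sr(2) nk deg_b[OF that] by (auto simp: d_def b_def deg_below_def coeff_eq_0)
  have "coeff_mat n n (u \<circ> \<pi>) * F = coeff_mat n n d"
    unfolding F_def
  proof (rule coeff_mat_times_poly_mat[OF assms(3,5)])
    fix i
    assume i: "i < n"
    then have "\<pi> i < n"
      by (auto simp: \<pi>_def nk)
    then show "deg_below n ((u \<circ> \<pi>) i)"
      by (simp add: deg_u deg_below_degree)
    show "deg_below n (d i)"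
      using i by (rule low_d)
    show "g dvd (u \<circ> \<pi>) i * f - d i"
    proof (cases "i < k")
      case True
      then show ?thesis
        by (simp add: \<pi>_def u_def d_def nk)
    next
      case False
      \<comment> \<open>Row \<open>i\<close> belongs to \<open>e = n - 1 - i\<close>, where
        \<open>- s e * f - r e\<close> is \<open>- t^e g\<close>.\<close>
      then have "m - 1 - (i - k) = n - 1 - i"
        using i nk by auto
      then have "(u \<circ> \<pi>) i * f - d i = - (?t (n - 1 - i) * g)"
        using False i nk by (auto simp: \<pi>_def u_def d_def sr(1))
      then show ?thesis
        by simp
    qed
  qed
  also have "coeff_mat n n d = diag_block_mat [1\<^sub>m k, G] * coeff_mat n n b"
  proof -
    \<comment> \<open>The coordinate matrix of \<open>t^(m-1), ..., 1\<close> is the identity, so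
      this product exhibits the rows of \<open>G\<close> as remainders.\<close>
    have "coeff_mat m m (\<lambda>i. ?t (m - 1 - i)) * G = coeff_mat m m (\<lambda>i. r (m - 1 - i))"
      unfolding G_def by (rule coeff_mat_times_poly_mat[OF assms(2,4)])
        (auto simp: sr deg_below_degree degree_monom_eq)
    moreover have "coeff_mat m m (\<lambda>i. ?t (m - 1 - i)) = 1\<^sub>m m"
      by (auto intro!: eq_matI)
    ultimately have G_eq: "G = coeff_mat m m (\<lambda>i. r (m - 1 - i))"
      using G by simp
    define B1 where "B1 = mat k k (\<lambda>(i, j). coeff (b i) (n - 1 - j))"
    define B2 where "B2 = mat k m (\<lambda>(i, j). coeff (b i) (m - 1 - j))"
    \<comment> \<open>The last \<open>m\<close> members of \<open>b\<close> are
      \<open>t^(m-1), ..., 1\<close>, whence the zero and identity blocks.\<close>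
    have "coeff_mat n n b = four_block_mat B1 B2 (0\<^sub>m m k) (1\<^sub>m m)"
      by (intro eq_matI) (auto simp: B1_def B2_def nk b_def add.commute[of m k])
    moreover have "diag_block_mat [1\<^sub>m k, G] = four_block_mat (1\<^sub>m k) (0\<^sub>m k m) (0\<^sub>m m k) G"
      using G unfolding diag_block_mat.simps(2)[of _ "[_]"] diag_block_mat_singleton Let_def by auto
    ultimately have "diag_block_mat [1\<^sub>m k, G] * coeff_mat n n b = four_block_mat B1 B2 (0\<^sub>m m k) G"
      using G by (simp only:)
        (subst mult_four_block_mat[of _ k k _ m _ m _ _ k _ m], auto simp: B1_def B2_def)
    \<comment> \<open>The first \<open>k\<close> rows of \<open>b\<close> and \<open>d\<close>
      agree; below them, remainders of degree under \<open>m\<close> vanish in the first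
      \<open>k\<close> columns.\<close>
    also have "\<dots> = coeff_mat n n d"
      using sr(2) G by (intro eq_matI) (auto simp: B1_def B2_def nk b_def d_def G_eq deg_below_def add.commute[of m k])
    finally show ?thesis ..
  qed
  finally have "coeff_mat n n (u \<circ> \<pi>) * F = diag_block_mat [1\<^sub>m k, G] * coeff_mat n n b" .
  moreover have "diag_block_mat [1\<^sub>m k, G] \<in> carrier_mat n n"
    using G nk by (intro carrier_matI) (simp_all add: dim_diag_block_mat del: diag_block_mat.simps)
  ultimately show ?thesis
    unfolding F_def[symmetric] G_def[symmetric] k_def[symmetric]
    using F u\<pi>_unit b_unit equivalent_matI[OF _ _ coeff_mat_carrier coeff_mat_carrier] by blast
qed

end
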